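(* Let $(x_n)_{n\ge0}$ be the $\mathbb R^d$-valued iterates $x_{n+1}=x_n+a(n)[h(x_n)+M_{n+1}]$, where: (A1) $h:\mathbb R^d\to\mathbb R^d$ is Lipschitz; (A2) $a(n)>0$, $\sum_n a(n)=\infty$, $\sum_n a(n)^2<\infty$, and there is $c>0$ such that $a(n)\le c\,a(m)$ for all $n\ge m$; (A3) $(M_n)_{n\ge1}$ is a square integrable martingale difference sequence with respect to $\mathcal F_n=\sigma(x_0,M_1,\ldots,M_n)$, i.e. $E[M_{n+1}\mid\mathcal F_n]=0$ a.s. for all $n\ge0$, and $E[\|M_{n+1}\|^2\mid\mathcal F_n]\le c(1+\|x_n\|^2)$ a.s. for all $n\ge 0$ and some $0<c<\infty$. Let $V$ be the Liapunov function described in the context, and assume in addition: (A4) $V$ is twice differentiable and all its second order derivatives are bounded by a constant: $|\partial_i\partial_jV(x)|<c$ for all $i,j$ and $x$, for some $0<c<\infty$; (A5) $\|x\|^2<c(1+V(x))$ for all $x$ and some $0<c<\infty$. Then the iterates $\{x_n\}$ are tight.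
   Context: $V:\mathbb R^d\to[0,\infty)$ is differentiable with $\lim_{\|x\|\uparrow\infty}V(x)=\infty$ and $\nabla V(x)\cdot h(x)\le 0$ for all $x$; the set $H:=\{x:\nabla V(x)\cdot h(x)=0\}$ is assumed to coincide with $\{x:V(x)=0\}$. The iterates $\{x_n\}$ are tight if for every $\epsilon>0$ there is a compact $K\subset\mathbb R^d$ with $\mathbb P[x_n\in K]>1-\epsilon$ for all $n$. *)

theory Defs
  imports "HOL-Probability.Probability"
begin

definition partial_deriv :: "'d \<Rightarrow> (real ^ 'd \<Rightarrow> real) \<Rightarrow> real ^ 'd \<Rightarrow> real" where
  "partial_deriv i f x = deriv (\<lambda>t. f (x + t *\<^sub>R axis i 1)) 0"

definition gradient :: "(real ^ 'd \<Rightarrow> real) \<Rightarrow> real ^ 'd \<Rightarrow> real ^ 'd" where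
  "gradient f x = (\<chi> i. partial_deriv i f x)"

definition twice_differentiable :: "(real ^ 'd \<Rightarrow> real) \<Rightarrow> bool" where
  "twice_differentiable f \<longleftrightarrow>
     (\<forall>x. f differentiable (at x)) \<and> (\<forall>x. gradient f differentiable (at x))"

text \<open>The noise is indexed from 1: the value of a noise process at index 0 is never used.\<close>

definition noise_sigma ::
    "'w measure \<Rightarrow> ('w \<Rightarrow> real ^ 'd) \<Rightarrow> (nat \<Rightarrow> 'w \<Rightarrow> real ^ 'd) \<Rightarrow> nat \<Rightarrow> 'w measure" where
  "noise_sigma P x0 M n = sigma (space P)
     ({x0 -` A \<inter> space P | A. A \<in> sets borel} \<union>
      {M k -` A \<inter> space P | k A. k \<in> {1..n} \<and> A \<in> sets borel})"

text \<open>The library only has conditional expectations of real functions, so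
  the conditional expectation of a random vector is taken componentwise.\<close>

definition vec_cond_exp ::
    "'w measure \<Rightarrow> 'w measure \<Rightarrow> ('w \<Rightarrow> real ^ 'd) \<Rightarrow> 'w \<Rightarrow> real ^ 'd" where
  "vec_cond_exp P F f = (\<lambda>\<omega>. \<chi> i. real_cond_exp P F (\<lambda>\<omega>'. f \<omega>' $ i) \<omega>)"

text \<open>Adaptedness holds by construction of the filtration, and integrability follows from
  square integrability on a probability space.\<close>

definition sq_integrable_mart_diff ::
    "'w measure \<Rightarrow> ('w \<Rightarrow> real ^ 'd) \<Rightarrow> (nat \<Rightarrow> 'w \<Rightarrow> real ^ 'd) \<Rightarrow> bool" where
  "sq_integrable_mart_diff P x0 M \<longleftrightarrow>
     (\<forall>n\<ge>1. M n \<in> borel_measurable P \<and> integrable P (\<lambda>\<omega>. (norm (M n \<omega>))\<^sup>2)) \<and>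
     (\<forall>n. AE \<omega> in P. vec_cond_exp P (noise_sigma P x0 M n) (M (Suc n)) \<omega> = 0)"

definition tight_sequence :: "'w measure \<Rightarrow> (nat \<Rightarrow> 'w \<Rightarrow> real ^ 'd) \<Rightarrow> bool" where
  "tight_sequence P x \<longleftrightarrow>
     (\<forall>\<epsilon>>0. \<exists>K. compact K \<and> (\<forall>n. measure P {\<omega> \<in> space P. x n \<omega> \<in> K} > 1 - \<epsilon>))"

lemma gderiv_gradient:
  fixes f :: "real ^ 'd \<Rightarrow> real"
  assumes "f differentiable (at x)"
  shows "GDERIV f x :> gradient f x"
proof -
  obtain D where D: "(f has_derivative D) (at x)"
    using assms by (auto simp: differentiable_def)
  interpret bounded_linear D by (rule has_derivative_bounded_linear[OF D])
  have pd: "partial_deriv i f x = D (axis i 1)" for i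
  proof -
    have "((\<lambda>t. f (x + t *\<^sub>R axis i 1)) has_derivative (\<lambda>t. D (t *\<^sub>R axis i 1))) (at 0)"
      by (rule has_derivative_compose[of _ _ _ _ f D]) (auto intro!: derivative_eq_intros simp: D)
    then have "((\<lambda>t. f (x + t *\<^sub>R axis i 1)) has_field_derivative D (axis i 1)) (at 0)"
      by (simp add: has_field_derivative_def scaleR mult_commute_abs)
    then show ?thesis
      unfolding partial_deriv_def by (rule DERIV_imp_deriv)
  qed
  have "D h = h \<bullet> gradient f x" for h
  proof -
    have "D h = D (\<Sum>i\<in>UNIV. h $ i *\<^sub>R axis i 1)"
      using basis_expansion[of h] by (simp add: scalar_mult_eq_scaleR)
    then show ?thesis
      by (simp add: sum scaleR inner_vec_def gradient_def pd)
  qed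
  then have "D = (\<lambda>h. h \<bullet> gradient f x)"
    by blast
  then show ?thesis
    using D by (simp add: gderiv_def)
qed

lemma subalgebra_noise_sigma:
  assumes "x0 \<in> borel_measurable P" "\<And>n. n \<ge> 1 \<Longrightarrow> M n \<in> borel_measurable P"
  shows "subalgebra P (noise_sigma P x0 M n)"
  using assms unfolding subalgebra_def noise_sigma_def
  by (auto intro!: sets.sigma_sets_subset simp: measurable_sets space_measure_of_conv
        sets_measure_of_conv)

end

theory Submission
  imports Defs
begin

text \<open>
  Expand \<open>V\<close> to second order along one step of the recursion. Bounded second derivatives make
  the remainder at most a constant times \<open>a(n)\<^sup>2 |h(x\<^sub>n) + M\<^sub>n\<^sub>+\<^sub>1|\<^sup>2\<close>. In the first-order part,
  the drift \<open>\<nabla>V \<bullet> h\<close> is nonpositive and the noise \<open>\<nabla>V(x\<^sub>n) \<bullet> M\<^sub>n\<^sub>+\<^sub>1\<close> has mean zero, because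
  \<open>\<nabla>V(x\<^sub>n)\<close> is known at time \<open>n\<close>. The conditional second moments of \<open>h(x\<^sub>n)\<close> and \<open>M\<^sub>n\<^sub>+\<^sub>1\<close> are
  at most a constant times \<open>1 + |x\<^sub>n|\<^sup>2\<close>, hence at most a constant times \<open>1 + V(x\<^sub>n)\<close>. So
  \<open>E[1 + V(x\<^sub>n\<^sub>+\<^sub>1)] \<le> (1 + C a(n)\<^sup>2) E[1 + V(x\<^sub>n)]\<close> (lemma \<open>expected_lyapunov_step\<close>), and since
  \<open>\<Sum> a(n)\<^sup>2\<close> converges, these expectations stay bounded (lemma \<open>discrete_Gronwall_bounded\<close>).
  Markov's inequality then puts \<open>x\<^sub>n\<close> with high probability, uniformly in \<open>n\<close>, in a sublevel
  set of \<open>V\<close>, which is compact by coercivity.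

  The initial value need not have a second moment, so \<open>E[V(x\<^sub>0)]\<close> may be infinite. All expectations
  are therefore taken over an event \<open>A = {|x\<^sub>0| \<le> R}\<close>. It is known at time \<open>0\<close>, so the noise stays
  centred on it, and its complement has small probability when \<open>R\<close> is large.
\<close>

section \<open>Functions with bounded second partial derivatives\<close>

lemma gradient_bounded_imp_Lipschitz:
  fixes f :: "real ^ 'd \<Rightarrow> real" and c :: real
  assumes diff: "\<And>y. f differentiable (at y)"
    and bound: "\<And>y i. \<bar>partial_deriv i f y\<bar> \<le> c"
  shows "\<bar>f y - f z\<bar> \<le> CARD('d) * c * norm (y - z)"
proof -
  have grad: "norm (gradient f w) \<le> CARD('d) * c" for w
  proof -
    have "norm (gradient f w) \<le> (\<Sum>i\<in>UNIV. \<bar>gradient f w $ i\<bar>)"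
      by (rule norm_le_l1_cart)
    also have "\<dots> \<le> (\<Sum>i\<in>(UNIV :: 'd set). c)"
      by (intro sum_mono) (simp add: gradient_def bound)
    finally show ?thesis
      by simp
  qed
  have "norm (f y - f z) \<le> CARD('d) * c * norm (y - z)"
  proof (rule differentiable_bound[where S = UNIV and f' = "\<lambda>w v. v \<bullet> gradient f w"])
    show "onorm (\<lambda>v. v \<bullet> gradient f w) \<le> CARD('d) * c" for w
    proof (rule onorm_le)
      fix v :: "real ^ 'd"
      have "norm (v \<bullet> gradient f w) \<le> norm v * norm (gradient f w)"
        by (simp add: Cauchy_Schwarz_ineq2)
      also have "\<dots> \<le> norm v * (CARD('d) * c)"
        by (intro mult_left_mono grad) simp
      finally show "norm (v \<bullet> gradient f w) \<le> CARD('d) * c * norm v"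
        by (simp add: mult_ac)
    qed
  qed (use gderiv_gradient[OF diff] in \<open>auto simp: gderiv_def\<close>)
  then show ?thesis
    by simp
qed

lemma bounded_second_partials_imp_Lipschitz_gradient:
  fixes V :: "real ^ 'd \<Rightarrow> real" and c :: real
  assumes diff: "\<And>y. gradient V differentiable (at y)"
    and bound: "\<And>i j y. \<bar>partial_deriv i (partial_deriv j V) y\<bar> \<le> c"
  shows "norm (gradient V y - gradient V z) \<le> (CARD('d))\<^sup>2 * c * norm (y - z)"
proof -
  have diff_j: "partial_deriv j V differentiable (at w)" for j w
  proof -
    obtain D where "(gradient V has_derivative D) (at w)"
      using diff by (auto simp: differentiable_def)
    then have "((\<lambda>v. gradient V v $ j) has_derivative (\<lambda>v. D v $ j)) (at w)"
      by (rule bounded_linear.has_derivative[OF bounded_linear_vec_nth])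
    then show ?thesis
      by (auto simp: gradient_def differentiable_def)
  qed
  have "norm (gradient V y - gradient V z) \<le> (\<Sum>j\<in>UNIV. \<bar>(gradient V y - gradient V z) $ j\<bar>)"
    by (rule norm_le_l1_cart)
  also have "\<dots> \<le> (\<Sum>j\<in>(UNIV :: 'd set). CARD('d) * c * norm (y - z))"
    by (intro sum_mono) (simp add: gradient_def gradient_bounded_imp_Lipschitz[OF diff_j bound])
  finally show ?thesis
    by (simp add: power2_eq_square mult_ac)
qed

text \<open>
  By the mean value theorem the increment of \<open>V\<close> is \<open>\<nabla>V(y + t z) \<bullet> z\<close> for some \<open>t\<close> between 0
  and 1, and replacing this gradient by \<open>\<nabla>V(y)\<close> costs at most \<open>K |z|\<^sup>2\<close>.
\<close>
lemma quadratic_upper_bound: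
  fixes V :: "real ^ 'd \<Rightarrow> real"
  assumes diff: "\<And>y. V differentiable (at y)"
    and Lip: "\<And>y z. norm (gradient V y - gradient V z) \<le> K * norm (y - z)"
  shows "V (y + z) \<le> V y + gradient V y \<bullet> z + K * (norm z)\<^sup>2"
proof -
  have deriv: "((\<lambda>t. V (y + t *\<^sub>R z)) has_real_derivative gradient V (y + t *\<^sub>R z) \<bullet> z) (at t)" for t
  proof -
    have V': "(V has_derivative (\<lambda>v. v \<bullet> gradient V (y + t *\<^sub>R z))) (at (y + t *\<^sub>R z))"
      using gderiv_gradient[OF diff] by (simp add: gderiv_def)
    have "((\<lambda>t. y + t *\<^sub>R z) has_derivative (\<lambda>s. s *\<^sub>R z)) (at t)"
      by (auto intro!: derivative_eq_intros)
    from has_derivative_compose[OF this V']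
    have "((\<lambda>t. V (y + t *\<^sub>R z)) has_derivative (\<lambda>s. (s *\<^sub>R z) \<bullet> gradient V (y + t *\<^sub>R z))) (at t)" .
    then show ?thesis
      by (simp add: has_field_derivative_def inner_commute mult_commute_abs)
  qed
  define f where "f t = V (y + t *\<^sub>R z)" for t
  define f' where "f' t = gradient V (y + t *\<^sub>R z) \<bullet> z" for t
  have "\<exists>t>0. t < 1 \<and> f 1 - f 0 = (1 - 0) * f' t"
    using deriv by (intro MVT2) (auto simp: f_def f'_def)
  then obtain t where t: "0 < t" "t < 1" and mvt: "f 1 - f 0 = f' t"
    by auto
  have K: "0 \<le> K * norm z"
    using order_trans[OF norm_ge_zero Lip[of z 0]] by simp
  have "(gradient V (y + t *\<^sub>R z) - gradient V y) \<bullet> z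
      \<le> norm (gradient V (y + t *\<^sub>R z) - gradient V y) * norm z"
    by (rule norm_cauchy_schwarz)
  also have "\<dots> \<le> (K * norm (t *\<^sub>R z)) * norm z"
    using Lip[of "y + t *\<^sub>R z" y] by (intro mult_right_mono) auto
  also have "\<dots> = t * (K * (norm z)\<^sup>2)"
    using t by (simp add: power2_eq_square)
  also have "\<dots> \<le> 1 * (K * (norm z)\<^sup>2)"
    using t K by (intro mult_right_mono) (auto simp: power2_eq_square mult.assoc[symmetric])
  finally show ?thesis
    using mvt by (simp add: f_def f'_def inner_diff_left)
qed

lemma Lipschitz_imp_quadratic_growth:
  fixes g :: "'a::real_normed_vector \<Rightarrow> 'b::real_normed_vector"
  assumes Lip: "\<And>y z. norm (g y - g z) \<le> K * norm (y - z)"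
  shows "(norm (g y))\<^sup>2 \<le> 2 * ((norm (g 0))\<^sup>2 + K\<^sup>2) * (1 + (norm y)\<^sup>2)"
proof -
  have "norm (g y) \<le> norm (g 0) + K * norm y"
    using Lip[of y 0] norm_triangle_sub[of "g y" "g 0"] by simp
  then have "(norm (g y))\<^sup>2 \<le> (norm (g 0) + K * norm y)\<^sup>2"
    by (intro power_mono) auto
  also have "\<dots> \<le> 2 * (norm (g 0))\<^sup>2 + 2 * (K * norm y)\<^sup>2"
    using sum_squares_bound[of "norm (g 0)" "K * norm y"] by (simp add: power2_sum)
  also have "\<dots> \<le> 2 * ((norm (g 0))\<^sup>2 + K\<^sup>2) * (1 + (norm y)\<^sup>2)"
    by (simp add: algebra_simps power_mult_distrib)
  finally show ?thesis .
qed

lemma Lipschitz_gradient_imp_quadratic_growth: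
  fixes V :: "real ^ 'd \<Rightarrow> real"
  assumes diff: "\<And>y. V differentiable (at y)"
    and Lip: "\<And>y z. norm (gradient V y - gradient V z) \<le> K * norm (y - z)"
    and "0 \<le> K" and nonneg: "\<And>y. 0 \<le> V y"
  shows "V y \<le> (V 0 + norm (gradient V 0) + K) * (1 + (norm y)\<^sup>2)"
proof -
  have "V y \<le> V 0 + gradient V 0 \<bullet> y + K * (norm y)\<^sup>2"
    using quadratic_upper_bound[OF diff Lip, of 0 y] by simp
  also have "gradient V 0 \<bullet> y \<le> norm (gradient V 0) * norm y"
    by (rule norm_cauchy_schwarz)
  also have "norm (gradient V 0) * norm y \<le> norm (gradient V 0) * (1 + (norm y)\<^sup>2)"
  proof (rule mult_left_mono)
    show "norm y \<le> 1 + (norm y)\<^sup>2"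
      using sum_squares_bound[of 1 "norm y"] norm_ge_zero[of y] unfolding power_one by linarith
  qed simp
  finally show ?thesis
    using assms(3) mult_nonneg_nonneg[OF nonneg[of 0] zero_le_power2[of "norm y"]]
    unfolding distrib_left distrib_right by linarith
qed

section \<open>Square integrable random vectors and martingale differences\<close>

lemma borel_measurable_vec_component [measurable]:
  "(\<lambda>v :: real ^ 'd. v $ i) \<in> borel_measurable borel"
  by (intro borel_measurable_continuous_onI continuous_intros)

lemma integrable_inner_sq:
  fixes X Y :: "'w \<Rightarrow> 'a::{euclidean_space}"
  assumes [measurable]: "X \<in> borel_measurable P" "Y \<in> borel_measurable P"
    and "integrable P (\<lambda>\<omega>. (norm (X \<omega>))\<^sup>2)" "integrable P (\<lambda>\<omega>. (norm (Y \<omega>))\<^sup>2)"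
  shows "integrable P (\<lambda>\<omega>. X \<omega> \<bullet> Y \<omega>)"
proof (rule Bochner_Integration.integrable_bound)
  show "integrable P (\<lambda>\<omega>. (norm (X \<omega>))\<^sup>2 + (norm (Y \<omega>))\<^sup>2)"
    using assms by simp
  have "\<bar>u \<bullet> v\<bar> \<le> (norm u)\<^sup>2 + (norm v)\<^sup>2" for u v :: 'a
    using Cauchy_Schwarz_ineq2[of u v] sum_squares_bound[of "norm u" "norm v"]
      mult_nonneg_nonneg[OF norm_ge_zero[of u] norm_ge_zero[of v]] by linarith
  then show "AE \<omega> in P. norm (X \<omega> \<bullet> Y \<omega>) \<le> norm ((norm (X \<omega>))\<^sup>2 + (norm (Y \<omega>))\<^sup>2)"
    by simp
qed simp

lemma norm_add_sq_le:
  fixes u v :: "'a::real_normed_vector"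
  shows "(norm (u + v))\<^sup>2 \<le> 2 * ((norm u)\<^sup>2 + (norm v)\<^sup>2)"
proof -
  have "(norm (u + v))\<^sup>2 \<le> (norm u + norm v)\<^sup>2"
    by (intro power_mono norm_triangle_ineq) simp
  also have "\<dots> \<le> 2 * ((norm u)\<^sup>2 + (norm v)\<^sup>2)"
    using sum_squares_bound[of "norm u" "norm v"] by (simp add: power2_sum)
  finally show ?thesis .
qed

text \<open>
  Square integrability of both factors makes each product of components integrable, so that the
  component of \<open>G\<close>, known given \<open>F\<close>, can be pulled out of the conditional expectation.
\<close>
lemma (in sigma_finite_subalgebra) integral_inner_cond_exp_zero:
  fixes G N :: "'a \<Rightarrow> real ^ 'd"
  assumes G[measurable]: "G \<in> borel_measurable F" and N[measurable]: "N \<in> borel_measurable M"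
    and G2: "integrable M (\<lambda>\<omega>. (norm (G \<omega>))\<^sup>2)" and N2: "integrable M (\<lambda>\<omega>. (norm (N \<omega>))\<^sup>2)"
    and zero: "AE \<omega> in M. vec_cond_exp M F N \<omega> = 0"
  shows "(\<integral>\<omega>. G \<omega> \<bullet> N \<omega> \<partial>M) = 0"
proof -
  have [measurable]: "G \<in> borel_measurable M"
    by (rule measurable_from_subalg[OF subalg G])
  have sq: "integrable M (\<lambda>\<omega>. (norm (Z \<omega> $ i))\<^sup>2)"
    if [measurable]: "Z \<in> borel_measurable M" and "integrable M (\<lambda>\<omega>. (norm (Z \<omega>))\<^sup>2)"
    for Z :: "'a \<Rightarrow> real ^ 'd" and i
  proof (rule Bochner_Integration.integrable_bound[OF that(2)])
    show "AE \<omega> in M. norm ((norm (Z \<omega> $ i))\<^sup>2) \<le> norm ((norm (Z \<omega>))\<^sup>2)"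
      using power_mono[OF component_le_norm_cart abs_ge_zero, of _ i 2] by simp
  qed simp
  have int: "integrable M (\<lambda>\<omega>. G \<omega> $ i * N \<omega> $ i)" for i
    using integrable_inner_sq[of "\<lambda>\<omega>. G \<omega> $ i" M "\<lambda>\<omega>. N \<omega> $ i"] sq[OF _ G2] sq[OF _ N2] by simp
  have "(\<integral>\<omega>. G \<omega> $ i * N \<omega> $ i \<partial>M) = 0" for i
  proof -
    have "(\<integral>\<omega>. G \<omega> $ i * N \<omega> $ i \<partial>M) = (\<integral>\<omega>. G \<omega> $ i * real_cond_exp M F (\<lambda>\<omega>. N \<omega> $ i) \<omega> \<partial>M)"
      by (rule real_cond_exp_intg(2)[symmetric, OF int]) auto
    also have "\<dots> = (\<integral>\<omega>. 0 \<partial>M)"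
    proof (rule integral_cong_AE)
      show "AE \<omega> in M. G \<omega> $ i * real_cond_exp M F (\<lambda>\<omega>. N \<omega> $ i) \<omega> = 0"
        using zero by (auto simp: vec_cond_exp_def vec_eq_iff)
    qed auto
    finally show ?thesis
      by simp
  qed
  then show ?thesis
    using int by (simp add: inner_vec_def Bochner_Integration.integral_sum)
qed

lemma (in prob_space) norm_tail_small:
  fixes X :: "'a \<Rightarrow> 'b::euclidean_space"
  assumes [measurable]: "X \<in> borel_measurable M" and "0 < \<epsilon>"
  obtains R where "prob {\<omega> \<in> space M. R < norm (X \<omega>)} < \<epsilon>"
proof -
  have "(\<lambda>n. prob {\<omega> \<in> space M. real n < norm (X \<omega>)})
      \<longlonglongrightarrow> prob (\<Inter>n. {\<omega> \<in> space M. real n < norm (X \<omega>)})"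
    by (rule finite_Lim_measure_decseq) (auto simp: decseq_def)
  moreover have "(\<Inter>n. {\<omega> \<in> space M. real n < norm (X \<omega>)}) = {}"
    using reals_Archimedean2 not_less_iff_gr_or_eq by fastforce
  ultimately have "(\<lambda>n. prob {\<omega> \<in> space M. real n < norm (X \<omega>)}) \<longlonglongrightarrow> 0"
    by simp
  then have "\<forall>\<^sub>F n in sequentially. prob {\<omega> \<in> space M. real n < norm (X \<omega>)} < \<epsilon>"
    using assms(2) by (rule order_tendstoD)
  then show ?thesis
    using that by (auto simp: eventually_sequentially)
qed

section \<open>The filtration of the iterates\<close>

lemma space_noise_sigma [simp]: "space (noise_sigma P x0 M n) = space P"
  unfolding noise_sigma_def by (rule space_measure_of_conv)

lemma sets_noise_sigma:
  "sets (noise_sigma P x0 M n) = sigma_sets (space P)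
     ({x0 -` A \<inter> space P | A. A \<in> sets borel} \<union>
      {M k -` A \<inter> space P | k A. k \<in> {1..n} \<and> A \<in> sets borel})"
  unfolding noise_sigma_def by (rule sets_measure_of) auto

lemma noise_sigma_mono:
  fixes M :: "nat \<Rightarrow> 'a \<Rightarrow> real ^ 'd"
  assumes "m \<le> n"
  shows "subalgebra (noise_sigma P x0 M n) (noise_sigma P x0 M m)"
proof -
  have "{M k -` A \<inter> space P | k A. k \<in> {1..m} \<and> A \<in> sets borel}
      \<subseteq> {M k -` A \<inter> space P | k A. k \<in> {1..n} \<and> A \<in> sets borel}"
  proof clarify
    fix k and A :: "(real ^ 'd) set"
    assume "k \<in> {1..m}" "A \<in> sets borel"
    then have "k \<in> {1..n}"
      using assms by simp
    then show "\<exists>k' A'. M k -` A \<inter> space P = M k' -` A' \<inter> space P \<and> k' \<in> {1..n} \<and> A' \<in> sets borel"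
      using \<open>A \<in> sets borel\<close> by blast
  qed
  then show ?thesis
    unfolding subalgebra_def sets_noise_sigma by (intro conjI sigma_sets_mono' Un_mono) auto
qed

lemma initial_measurable_noise_sigma: "x0 \<in> borel_measurable (noise_sigma P x0 M n)"
  by (rule measurableI) (auto simp: sets_noise_sigma intro!: sigma_sets.Basic)

lemma noise_measurable_noise_sigma:
  assumes "1 \<le> k" "k \<le> n"
  shows "M k \<in> borel_measurable (noise_sigma P x0 M n)"
  using assms by (intro measurableI) (auto simp: sets_noise_sigma intro!: sigma_sets.Basic)

text \<open>
  Measurability with respect to the noise filtration, and not only with respect to \<open>P\<close>, is what
  makes functions of \<open>x n\<close> constants for the conditional expectations of \<open>M (Suc n)\<close>.
\<close>
lemma iterates_adapted:
  fixes x M :: "nat \<Rightarrow> 'w \<Rightarrow> real ^ 'd"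
  assumes iter: "\<And>n \<omega>. \<omega> \<in> space P \<Longrightarrow>
      x (Suc n) \<omega> = x n \<omega> + a n *\<^sub>R (h (x n \<omega>) + M (Suc n) \<omega>)"
    and h[measurable]: "h \<in> borel_measurable borel"
  shows "x n \<in> borel_measurable (noise_sigma P (x 0) M n)"
proof (induction n)
  case 0
  show ?case
    by (rule initial_measurable_noise_sigma)
next
  case (Suc n)
  have [measurable]: "x n \<in> borel_measurable (noise_sigma P (x 0) M (Suc n))"
    by (rule measurable_from_subalg[OF noise_sigma_mono Suc]) simp
  have [measurable]: "M (Suc n) \<in> borel_measurable (noise_sigma P (x 0) M (Suc n))"
    by (rule noise_measurable_noise_sigma) auto
  have "(\<lambda>\<omega>. x n \<omega> + a n *\<^sub>R (h (x n \<omega>) + M (Suc n) \<omega>))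
      \<in> borel_measurable (noise_sigma P (x 0) M (Suc n))"
    by measurable
  then show ?case
    by (rule measurable_cong[THEN iffD1, rotated]) (simp add: iter)
qed

section \<open>One step of the recursion\<close>

text \<open>
  One step from the state \<open>X\<close>, known at the present time (\<open>F\<close>), with noise \<open>N\<close>. The event \<open>A\<close>
  localises to a set where \<open>X\<close> is square integrable; it is part of the present, so
  conditioning on \<open>F\<close> commutes with restricting to it. The function \<open>G\<close> stands for the gradient
  of \<open>V\<close>, and only its quadratic upper bound and its growth are kept. The factor
  in \<open>expected_lyapunov_step\<close> depends on the constants and the step size alone, and not on \<open>X\<close>,
  \<open>N\<close> and \<open>A\<close>, which is what allows the step to be iterated.
\<close>
locale lyapunov_step = finite_measure_subalgebra P F
  for P F :: "'w measure" +
  fixes V :: "real ^ 'd \<Rightarrow> real" and G h :: "real ^ 'd \<Rightarrow> real ^ 'd"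
    and K Cg Ch Cv C5 Cm :: real
    and X N :: "'w \<Rightarrow> real ^ 'd" and A :: "'w set"
  assumes V_meas [measurable]: "V \<in> borel_measurable borel"
    and G_meas [measurable]: "G \<in> borel_measurable borel"
    and h_meas [measurable]: "h \<in> borel_measurable borel"
    and V_nonneg: "\<And>y. 0 \<le> V y"
    and descent: "\<And>y. G y \<bullet> h y \<le> 0"
    and K_nonneg: "0 \<le> K"
    and quad: "\<And>y z. V (y + z) \<le> V y + G y \<bullet> z + K * (norm z)\<^sup>2"
    and G_growth: "\<And>y. (norm (G y))\<^sup>2 \<le> Cg * (1 + (norm y)\<^sup>2)"
    and h_growth: "\<And>y. (norm (h y))\<^sup>2 \<le> Ch * (1 + (norm y)\<^sup>2)"
    and V_growth: "\<And>y. V y \<le> Cv * (1 + (norm y)\<^sup>2)"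
    and V_lower: "\<And>y. (norm y)\<^sup>2 \<le> C5 * (1 + V y)"
    and Cm_nonneg: "0 \<le> Cm"
    and X_meas: "X \<in> borel_measurable F"
    and A_sets: "A \<in> sets F"
    and X_sq: "integrable P (\<lambda>\<omega>. indicator A \<omega> * (norm (X \<omega>))\<^sup>2)"
    and N_meas [measurable]: "N \<in> borel_measurable P"
    and N_sq: "integrable P (\<lambda>\<omega>. (norm (N \<omega>))\<^sup>2)"
    and N_mean: "AE \<omega> in P. vec_cond_exp P F N \<omega> = 0"
    and N_var: "AE \<omega> in P. real_cond_exp P F (\<lambda>\<omega>. (norm (N \<omega>))\<^sup>2) \<omega>
                  \<le> Cm * (1 + (norm (X \<omega>))\<^sup>2)"
begin

lemma X_meas_P [measurable]: "X \<in> borel_measurable P"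
  by (rule measurable_from_subalg[OF subalg X_meas])

lemma A_sets_P [measurable]: "A \<in> sets P"
  using subalg A_sets by (auto simp: subalgebra_def)

lemma integrable_of_quadratic_growth:
  fixes f :: "'w \<Rightarrow> real"
  assumes [measurable]: "f \<in> borel_measurable P"
    and nonneg: "\<And>\<omega>. 0 \<le> f \<omega>"
    and bound: "\<And>\<omega>. f \<omega> \<le> C * (1 + (norm (X \<omega>))\<^sup>2)"
  shows "integrable P (\<lambda>\<omega>. indicator A \<omega> * f \<omega>)"
proof (rule Bochner_Integration.integrable_bound)
  show "integrable P (\<lambda>\<omega>. C * (indicator A \<omega> + indicator A \<omega> * (norm (X \<omega>))\<^sup>2))"
    using X_sq by (auto intro!: integrable_real_indicator simp: less_top[symmetric])
  show "AE \<omega> in P. norm (indicator A \<omega> * f \<omega>)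
      \<le> norm (C * (indicator A \<omega> + indicator A \<omega> * (norm (X \<omega>))\<^sup>2))"
    using nonneg bound by (auto simp: indicator_def intro: order_trans[OF bound abs_ge_self])
qed simp

lemma integrable_A_N: "integrable P (\<lambda>\<omega>. indicator A \<omega> * (norm (N \<omega>))\<^sup>2)"
  using integrable_real_mult_indicator[OF A_sets_P N_sq] by (simp add: mult_ac)

lemma integrable_A_X: "integrable P (\<lambda>\<omega>. indicator A \<omega> * (1 + (norm (X \<omega>))\<^sup>2))"
  by (rule integrable_of_quadratic_growth[where C = 1]) auto

lemma integrable_A_h: "integrable P (\<lambda>\<omega>. indicator A \<omega> * (norm (h (X \<omega>)))\<^sup>2)"
  by (rule integrable_of_quadratic_growth) (auto intro: h_growth)

lemma integrable_A_V: "integrable P (\<lambda>\<omega>. indicator A \<omega> * V (X \<omega>))"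
  by (rule integrable_of_quadratic_growth) (auto intro: V_growth V_nonneg)

lemma integrable_A_one_plus_V: "integrable P (\<lambda>\<omega>. indicator A \<omega> * (1 + V (X \<omega>)))"
proof -
  have "integrable P (indicator A :: 'w \<Rightarrow> real)"
    by (auto intro!: integrable_real_indicator simp: less_top[symmetric])
  then show ?thesis
    using integrable_A_V by (simp add: distrib_left)
qed

text \<open>This carries the square integrability of the state on \<open>A\<close> over to the next step.\<close>
lemma next_square_integrable:
  "integrable P (\<lambda>\<omega>. indicator A \<omega> * (norm (X \<omega> + \<alpha> *\<^sub>R (h (X \<omega>) + N \<omega>)))\<^sup>2)"
proof (rule Bochner_Integration.integrable_bound)
  let ?f = "\<lambda>\<omega>. 2 * (indicator A \<omega> * (norm (X \<omega>))\<^sup>2)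
      + 4 * \<alpha>\<^sup>2 * (indicator A \<omega> * (norm (h (X \<omega>)))\<^sup>2) + 4 * \<alpha>\<^sup>2 * (indicator A \<omega> * (norm (N \<omega>))\<^sup>2)"
  show "integrable P ?f"
    using X_sq integrable_A_h integrable_A_N by simp
  have "(norm (X \<omega> + \<alpha> *\<^sub>R (h (X \<omega>) + N \<omega>)))\<^sup>2
      \<le> 2 * (norm (X \<omega>))\<^sup>2 + 4 * \<alpha>\<^sup>2 * (norm (h (X \<omega>)))\<^sup>2 + 4 * \<alpha>\<^sup>2 * (norm (N \<omega>))\<^sup>2" for \<omega>
  proof -
    have "\<alpha>\<^sup>2 * (norm (h (X \<omega>) + N \<omega>))\<^sup>2 \<le> \<alpha>\<^sup>2 * (2 * ((norm (h (X \<omega>)))\<^sup>2 + (norm (N \<omega>))\<^sup>2))"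
      by (intro mult_left_mono norm_add_sq_le) simp
    moreover have "(norm (\<alpha> *\<^sub>R (h (X \<omega>) + N \<omega>)))\<^sup>2 = \<alpha>\<^sup>2 * (norm (h (X \<omega>) + N \<omega>))\<^sup>2"
      by (simp only: norm_scaleR power_mult_distrib power2_abs)
    ultimately show ?thesis
      using norm_add_sq_le[of "X \<omega>" "\<alpha> *\<^sub>R (h (X \<omega>) + N \<omega>)"]
      by (simp add: distrib_left)
  qed
  then show "AE \<omega> in P. norm (indicator A \<omega> * (norm (X \<omega> + \<alpha> *\<^sub>R (h (X \<omega>) + N \<omega>)))\<^sup>2) \<le> norm (?f \<omega>)"
    by (auto simp: indicator_def)
qed simp

text \<open>
  Multiplying the gradient by the indicator of \<open>A\<close> makes it square integrable, and it is still
  determined by the present, so that it is orthogonal to the centred noise.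
\<close>
lemma noise_orthogonal:
  shows "integrable P (\<lambda>\<omega>. indicator A \<omega> * (G (X \<omega>) \<bullet> N \<omega>))"
    and "(\<integral>\<omega>. indicator A \<omega> * (G (X \<omega>) \<bullet> N \<omega>) \<partial>P) = 0"
proof -
  let ?Z = "\<lambda>\<omega>. indicator A \<omega> *\<^sub>R G (X \<omega>)"
  note X_meas [measurable] A_sets [measurable]
  have Z: "?Z \<in> borel_measurable F"
    by measurable
  have Z_sq: "integrable P (\<lambda>\<omega>. (norm (?Z \<omega>))\<^sup>2)"
  proof -
    have "(\<lambda>\<omega>. (norm (?Z \<omega>))\<^sup>2) = (\<lambda>\<omega>. indicator A \<omega> * (norm (G (X \<omega>)))\<^sup>2)"
      by (auto simp: indicator_def)
    then show ?thesis
      using integrable_of_quadratic_growth[of "\<lambda>\<omega>. (norm (G (X \<omega>)))\<^sup>2" Cg] G_growth by simp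
  qed
  show "integrable P (\<lambda>\<omega>. indicator A \<omega> * (G (X \<omega>) \<bullet> N \<omega>))"
    using integrable_inner_sq[OF measurable_from_subalg[OF subalg Z] N_meas Z_sq N_sq] by simp
  show "(\<integral>\<omega>. indicator A \<omega> * (G (X \<omega>) \<bullet> N \<omega>) \<partial>P) = 0"
    using integral_inner_cond_exp_zero[OF Z N_meas Z_sq N_sq N_mean] by simp
qed

text \<open>
  The variance bound is conditional, so it may be integrated over \<open>A\<close> only because \<open>A\<close> belongs to
  the present.
\<close>
lemma noise_energy:
  "(\<integral>\<omega>. indicator A \<omega> * (norm (N \<omega>))\<^sup>2 \<partial>P) \<le> Cm * (\<integral>\<omega>. indicator A \<omega> * (1 + (norm (X \<omega>))\<^sup>2) \<partial>P)"
proof -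
  let ?E = "real_cond_exp P F (\<lambda>\<omega>. (norm (N \<omega>))\<^sup>2)"
  have ind: "indicator A \<in> borel_measurable F"
    using A_sets by simp
  have "(\<integral>\<omega>. indicator A \<omega> * (norm (N \<omega>))\<^sup>2 \<partial>P) = (\<integral>\<omega>. indicator A \<omega> * ?E \<omega> \<partial>P)"
    by (rule real_cond_exp_intg(2)[symmetric, OF integrable_A_N ind]) simp
  also have "\<dots> \<le> (\<integral>\<omega>. Cm * (indicator A \<omega> * (1 + (norm (X \<omega>))\<^sup>2)) \<partial>P)"
  proof (rule integral_mono_AE)
    show "integrable P (\<lambda>\<omega>. indicator A \<omega> * ?E \<omega>)"
      by (rule real_cond_exp_intg(1)[OF integrable_A_N ind]) simp
    show "AE \<omega> in P. indicator A \<omega> * ?E \<omega> \<le> Cm * (indicator A \<omega> * (1 + (norm (X \<omega>))\<^sup>2))"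
      using N_var by eventually_elim (auto simp: indicator_def)
  qed (use integrable_A_X in auto)
  finally show ?thesis
    by simp
qed

text \<open>
  In the quadratic bound for the step \<open>\<alpha> (h(X) + N)\<close> the drift term is dropped by descent and the
  noise term integrates to zero, so that only terms of order \<open>\<alpha>\<^sup>2\<close> are added. Their expectation is
  at most a multiple of that of \<open>1 + |X|\<^sup>2\<close>, and \<open>V_lower\<close> turns this back into one of \<open>1 + V(X)\<close>.
\<close>
lemma expected_lyapunov_step:
  assumes "0 < \<alpha>"
  shows "(\<integral>\<omega>. indicator A \<omega> * (1 + V (X \<omega> + \<alpha> *\<^sub>R (h (X \<omega>) + N \<omega>))) \<partial>P)
      \<le> (1 + 2 * K * (Ch + Cm) * (1 + C5) * \<alpha>\<^sup>2) * (\<integral>\<omega>. indicator A \<omega> * (1 + V (X \<omega>)) \<partial>P)"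
proof -
  let ?Y = "\<lambda>\<omega>. X \<omega> + \<alpha> *\<^sub>R (h (X \<omega>) + N \<omega>)"
  let ?I = "\<lambda>f. (\<integral>\<omega>. indicator A \<omega> * f \<omega> \<partial>P)"
  let ?q = "2 * K * \<alpha>\<^sup>2"
  have q: "0 \<le> ?q"
    using K_nonneg by simp
  have Ch: "0 \<le> Ch"
    using order_trans[OF zero_le_power2 h_growth[of 0]] by simp
  have pointwise: "1 + V (?Y \<omega>)
      \<le> 1 + V (X \<omega>) + \<alpha> * (G (X \<omega>) \<bullet> N \<omega>) + ?q * (norm (h (X \<omega>)))\<^sup>2 + ?q * (norm (N \<omega>))\<^sup>2" for \<omega>
  proof -
    have "\<alpha> * (G (X \<omega>) \<bullet> h (X \<omega>)) \<le> 0"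
      using assms descent by (simp add: mult_nonneg_nonpos)
    moreover have "K * \<alpha>\<^sup>2 * (norm (h (X \<omega>) + N \<omega>))\<^sup>2
        \<le> K * \<alpha>\<^sup>2 * (2 * ((norm (h (X \<omega>)))\<^sup>2 + (norm (N \<omega>))\<^sup>2))"
      using K_nonneg by (intro mult_left_mono norm_add_sq_le) simp
    ultimately show ?thesis
      using quad[of "X \<omega>" "\<alpha> *\<^sub>R (h (X \<omega>) + N \<omega>)"]
      by (simp add: inner_add_right distrib_left power_mult_distrib mult_ac)
  qed
  let ?B = "\<lambda>\<omega>. indicator A \<omega> * (1 + V (X \<omega>)) + \<alpha> * (indicator A \<omega> * (G (X \<omega>) \<bullet> N \<omega>))
      + ?q * (indicator A \<omega> * (norm (h (X \<omega>)))\<^sup>2) + ?q * (indicator A \<omega> * (norm (N \<omega>))\<^sup>2)"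
  have B: "integrable P ?B"
    using integrable_A_one_plus_V noise_orthogonal(1) integrable_A_h integrable_A_N by simp
  have "?I (\<lambda>\<omega>. 1 + V (?Y \<omega>)) \<le> (\<integral>\<omega>. ?B \<omega> \<partial>P)"
  proof (rule integral_mono_AE[OF _ B])
    have le: "indicator A \<omega> * (1 + V (?Y \<omega>)) \<le> ?B \<omega>" for \<omega>
      using pointwise[of \<omega>] by (simp add: indicator_def)
    have ge: "0 \<le> indicator A \<omega> * (1 + V (?Y \<omega>))" for \<omega>
      using V_nonneg by (simp add: indicator_def add_nonneg_nonneg)
    show "integrable P (\<lambda>\<omega>. indicator A \<omega> * (1 + V (?Y \<omega>)))"
    proof (rule Bochner_Integration.integrable_bound[OF B])
      show "AE \<omega> in P. norm (indicator A \<omega> * (1 + V (?Y \<omega>))) \<le> norm (?B \<omega>)"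
        using order_trans[OF le abs_ge_self] ge by (intro AE_I2) (simp only: real_norm_def abs_of_nonneg)
    qed simp
    show "AE \<omega> in P. indicator A \<omega> * (1 + V (?Y \<omega>)) \<le> ?B \<omega>"
      using le by simp
  qed
  also have "\<dots> = ?I (\<lambda>\<omega>. 1 + V (X \<omega>)) + ?q * ?I (\<lambda>\<omega>. (norm (h (X \<omega>)))\<^sup>2) + ?q * ?I (\<lambda>\<omega>. (norm (N \<omega>))\<^sup>2)"
    using integrable_A_one_plus_V noise_orthogonal integrable_A_h integrable_A_N by simp
  also have "\<dots> \<le> ?I (\<lambda>\<omega>. 1 + V (X \<omega>)) + ?q * (Ch * ?I (\<lambda>\<omega>. 1 + (norm (X \<omega>))\<^sup>2))
      + ?q * (Cm * ?I (\<lambda>\<omega>. 1 + (norm (X \<omega>))\<^sup>2))"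
  proof (intro add_mono mult_left_mono noise_energy q order_refl)
    have "?I (\<lambda>\<omega>. (norm (h (X \<omega>)))\<^sup>2) \<le> (\<integral>\<omega>. Ch * (indicator A \<omega> * (1 + (norm (X \<omega>))\<^sup>2)) \<partial>P)"
      using integrable_A_h integrable_A_X h_growth
      by (intro integral_mono) (auto simp: indicator_def)
    then show "?I (\<lambda>\<omega>. (norm (h (X \<omega>)))\<^sup>2) \<le> Ch * ?I (\<lambda>\<omega>. 1 + (norm (X \<omega>))\<^sup>2)"
      by simp
  qed
  also have "\<dots> = ?I (\<lambda>\<omega>. 1 + V (X \<omega>)) + ?q * (Ch + Cm) * ?I (\<lambda>\<omega>. 1 + (norm (X \<omega>))\<^sup>2)"
    by (simp add: algebra_simps)
  also have "\<dots> \<le> ?I (\<lambda>\<omega>. 1 + V (X \<omega>)) + ?q * (Ch + Cm) * ((1 + C5) * ?I (\<lambda>\<omega>. 1 + V (X \<omega>)))"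
  proof (intro add_left_mono mult_left_mono)
    have "1 + (norm (X \<omega>))\<^sup>2 \<le> (1 + C5) * (1 + V (X \<omega>))" for \<omega>
      using V_lower[of "X \<omega>"] V_nonneg[of "X \<omega>"] by (simp add: algebra_simps)
    then have "?I (\<lambda>\<omega>. 1 + (norm (X \<omega>))\<^sup>2)
        \<le> (\<integral>\<omega>. (1 + C5) * (indicator A \<omega> * (1 + V (X \<omega>))) \<partial>P)"
      using integrable_A_one_plus_V integrable_A_X
      by (intro integral_mono) (auto simp: indicator_def)
    then show "?I (\<lambda>\<omega>. 1 + (norm (X \<omega>))\<^sup>2) \<le> (1 + C5) * ?I (\<lambda>\<omega>. 1 + V (X \<omega>))"
      by simp
    show "0 \<le> ?q * (Ch + Cm)"
      using K_nonneg Ch Cm_nonneg by simp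
  qed
  also have "\<dots> = (1 + 2 * K * (Ch + Cm) * (1 + C5) * \<alpha>\<^sup>2) * ?I (\<lambda>\<omega>. 1 + V (X \<omega>))"
  proof -
    have "J + ?q * (Ch + Cm) * ((1 + C5) * J) = (1 + 2 * K * (Ch + Cm) * (1 + C5) * \<alpha>\<^sup>2) * J" for J
      by (simp add: algebra_simps)
    then show ?thesis .
  qed
  finally show ?thesis .
qed

end

section \<open>From one step to tightness\<close>

text \<open>Iterating, the product of the factors \<open>1 + b(k)\<close> is at most \<open>exp (\<Sum> b)\<close>.\<close>
lemma discrete_Gronwall_bounded:
  fixes u b :: "nat \<Rightarrow> real"
  assumes step: "\<And>n. u (Suc n) \<le> (1 + b n) * u n"
    and u: "\<And>n. 0 \<le> u n" and b: "\<And>n. 0 \<le> b n" and sum: "summable b"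
  shows "u n \<le> exp (suminf b) * u 0"
proof -
  have "u n \<le> exp (\<Sum>k<n. b k) * u 0"
  proof (induction n)
    case (Suc n)
    have "u (Suc n) \<le> (1 + b n) * u n"
      by (rule step)
    also have "\<dots> \<le> exp (b n) * (exp (\<Sum>k<n. b k) * u 0)"
      using Suc u b by (intro mult_mono exp_ge_add_one_self) auto
    finally show ?case
      by (simp add: exp_add mult_ac)
  qed simp
  also have "\<dots> \<le> exp (suminf b) * u 0"
    using sum_le_suminf[OF sum, of "{..<n}"] b u by (intro mult_right_mono) auto
  finally show ?thesis .
qed

lemma coercive_sublevel_compact:
  fixes V :: "'a::euclidean_space \<Rightarrow> real"
  assumes cont: "continuous_on UNIV V" and coercive: "filterlim V at_top at_infinity"
  shows "compact {y. V y \<le> L}"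
proof -
  have "\<forall>\<^sub>F y in at_infinity. L < V y"
    using coercive by (simp add: filterlim_at_top_dense)
  then obtain b where b: "\<And>y. b \<le> norm y \<Longrightarrow> L < V y"
    by (auto simp: eventually_at_infinity)
  then have "bounded {y. V y \<le> L}"
    unfolding bounded_iff by (metis linorder_not_le mem_Collect_eq nle_le)
  moreover have "closed {y. V y \<le> L}"
    using cont by (intro closed_Collect_le) auto
  ultimately show ?thesis
    by (simp add: compact_eq_bounded_closed)
qed

theorem theorem3:
  fixes P :: "'w measure"
    and x M :: "nat \<Rightarrow> 'w \<Rightarrow> real ^ 'd"
    and h :: "real ^ 'd \<Rightarrow> real ^ 'd"
    and a :: "nat \<Rightarrow> real"
    and V :: "real ^ 'd \<Rightarrow> real"
  assumes prob: "prob_space P"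
    and x0: "x 0 \<in> borel_measurable P"
    and iter: "\<And>n \<omega>. \<omega> \<in> space P \<Longrightarrow>
                 x (Suc n) \<omega> = x n \<omega> + a n *\<^sub>R (h (x n \<omega>) + M (Suc n) \<omega>)"
    and A1: "\<exists>L. L-lipschitz_on UNIV h"
    and A2_pos: "\<And>n. a n > 0"
    and A2_div: "filterlim (\<lambda>N. \<Sum>n<N. a n) at_top sequentially"
    and A2_sq: "summable (\<lambda>n. (a n)\<^sup>2)"
    and A2_mono: "\<exists>c>0. \<forall>m n. n \<ge> m \<longrightarrow> a n \<le> c * a m"
    and A3_mds: "sq_integrable_mart_diff P (x 0) M"
    and A3_var: "\<exists>c>0. \<forall>n. AE \<omega> in P.
                   real_cond_exp P (noise_sigma P (x 0) M n) (\<lambda>\<omega>'. (norm (M (Suc n) \<omega>'))\<^sup>2) \<omega>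
                     \<le> c * (1 + (norm (x n \<omega>))\<^sup>2)"
    and V_nonneg: "\<And>y. V y \<ge> 0"
    and V_diff: "\<And>y. V differentiable (at y)"
    and V_coercive: "filterlim V at_top at_infinity"
    and V_descent: "\<And>y. gradient V y \<bullet> h y \<le> 0"
    and V_zero: "{y. gradient V y \<bullet> h y = 0} = {y. V y = 0}"
    and A4_diff: "twice_differentiable V"
    and A4_bound: "\<exists>c>0. \<forall>i j y. \<bar>partial_deriv i (partial_deriv j V) y\<bar> < c"
    and A5: "\<exists>c>0. \<forall>y. (norm y)\<^sup>2 < c * (1 + V y)"
  shows "tight_sequence P x"
proof -
  interpret prob_space P
    by (rule prob)
  obtain L where "L-lipschitz_on UNIV h"
    using A1 by blast
  then have h_Lip: "norm (h y - h z) \<le> L * norm (y - z)" for y z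
    by (metis UNIV_I dist_norm lipschitz_onD)
  obtain Cm where Cm: "0 < Cm" and var: "\<And>n. AE \<omega> in P.
      real_cond_exp P (noise_sigma P (x 0) M n) (\<lambda>\<omega>'. (norm (M (Suc n) \<omega>'))\<^sup>2) \<omega>
        \<le> Cm * (1 + (norm (x n \<omega>))\<^sup>2)"
    using A3_var by blast
  obtain c where c: "0 < c" "\<And>i j y. \<bar>partial_deriv i (partial_deriv j V) y\<bar> < c"
    using A4_bound by blast
  obtain C5 where C5: "0 < C5" "\<And>y. (norm y)\<^sup>2 < C5 * (1 + V y)"
    using A5 by blast
  have grad_diff: "gradient V differentiable (at y)" for y
    using A4_diff by (simp add: twice_differentiable_def)
  define K where "K = (real CARD('d))\<^sup>2 * c"
  have K: "0 \<le> K"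
    using c by (simp add: K_def)
  have grad_Lip: "norm (gradient V y - gradient V z) \<le> K * norm (y - z)" for y z
    using bounded_second_partials_imp_Lipschitz_gradient[OF grad_diff less_imp_le[OF c(2)]]
    by (simp add: K_def)
  have V_cont: "continuous_on UNIV V"
    by (intro differentiable_imp_continuous_on) (simp add: differentiable_on_def V_diff)
  have V_meas [measurable]: "V \<in> borel_measurable borel"
    by (rule borel_measurable_continuous_onI[OF V_cont])
  have G_meas: "gradient V \<in> borel_measurable borel"
    by (intro borel_measurable_continuous_onI differentiable_imp_continuous_on)
      (simp add: differentiable_on_def grad_diff)
  have h_meas: "h \<in> borel_measurable borel"
    using \<open>L-lipschitz_on UNIV h\<close>
    by (intro borel_measurable_continuous_onI lipschitz_on_continuous_on)
  have M_meas: "M n \<in> borel_measurable P" and M_sq: "integrable P (\<lambda>\<omega>. (norm (M n \<omega>))\<^sup>2)"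
    if "1 \<le> n" for n
    using A3_mds that by (auto simp: sq_integrable_mart_diff_def)
  have M_mean: "AE \<omega> in P. vec_cond_exp P (noise_sigma P (x 0) M n) (M (Suc n)) \<omega> = 0" for n
    using A3_mds by (simp add: sq_integrable_mart_diff_def)
  have sub: "subalgebra P (noise_sigma P (x 0) M n)" for n
    by (rule subalgebra_noise_sigma[OF x0 M_meas])
  have x_adapted: "x n \<in> borel_measurable (noise_sigma P (x 0) M n)" for n
    using iter h_meas by (rule iterates_adapted)
  have x_meas [measurable]: "x n \<in> borel_measurable P" for n
    by (rule measurable_from_subalg[OF sub x_adapted])

  have bounded_on_start: "\<exists>B. \<forall>n. integrable P (\<lambda>\<omega>. indicator {\<omega> \<in> space P. norm (x 0 \<omega>) \<le> R} \<omega> * (1 + V (x n \<omega>)))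
      \<and> (\<integral>\<omega>. indicator {\<omega> \<in> space P. norm (x 0 \<omega>) \<le> R} \<omega> * (1 + V (x n \<omega>)) \<partial>P) \<le> B" for R
  proof -
    \<comment> \<open>The truncation makes the starting value bounded, hence square integrable.\<close>
    define A where "A = {\<omega> \<in> space P. norm (x 0 \<omega>) \<le> R}"
    have A_F: "A \<in> sets (noise_sigma P (x 0) M n)" for n
    proof -
      note initial_measurable_noise_sigma[measurable]
      have "{\<omega> \<in> space (noise_sigma P (x 0) M n). norm (x 0 \<omega>) \<le> R} \<in> sets (noise_sigma P (x 0) M n)"
        by measurable
      then show ?thesis
        by (simp add: A_def)
    qed
    have step: "lyapunov_step P (noise_sigma P (x 0) M n) V (gradient V) h K
        (2 * ((norm (gradient V 0))\<^sup>2 + K\<^sup>2)) (2 * ((norm (h 0))\<^sup>2 + L\<^sup>2))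
        (V 0 + norm (gradient V 0) + K) C5 Cm (x n) (M (Suc n)) A"
      if "integrable P (\<lambda>\<omega>. indicator A \<omega> * (norm (x n \<omega>))\<^sup>2)" for n
    proof unfold_locales
      show "V y \<le> (V 0 + norm (gradient V 0) + K) * (1 + (norm y)\<^sup>2)" for y
        by (rule Lipschitz_gradient_imp_quadratic_growth[OF V_diff grad_Lip K V_nonneg])
    qed (use V_meas G_meas h_meas V_nonneg V_descent K quadratic_upper_bound[OF V_diff grad_Lip]
        Lipschitz_imp_quadratic_growth[of "gradient V", OF grad_Lip] Lipschitz_imp_quadratic_growth[of h, OF h_Lip]
        less_imp_le[OF C5(2)] less_imp_le[OF Cm] x_adapted A_F that M_meas M_sq M_mean var sub in simp_all)
    \<comment> \<open>The recursion holds on the space of \<open>P\<close> only, so it may be used under the integral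
        but not as an equality of functions.\<close>
    have next_cong: "(\<integral>\<omega>. indicator A \<omega> * f (x (Suc n) \<omega>) \<partial>P)
          = (\<integral>\<omega>. indicator A \<omega> * f (x n \<omega> + a n *\<^sub>R (h (x n \<omega>) + M (Suc n) \<omega>)) \<partial>P)"
        "integrable P (\<lambda>\<omega>. indicator A \<omega> * f (x (Suc n) \<omega>))
          \<longleftrightarrow> integrable P (\<lambda>\<omega>. indicator A \<omega> * f (x n \<omega> + a n *\<^sub>R (h (x n \<omega>) + M (Suc n) \<omega>)))"
      for f :: "real ^ 'd \<Rightarrow> real" and n
      by (auto intro!: Bochner_Integration.integral_cong Bochner_Integration.integrable_cong simp: iter)
    have sq: "integrable P (\<lambda>\<omega>. indicator A \<omega> * (norm (x n \<omega>))\<^sup>2)" for n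
    proof (induction n)
      case 0
      have "A \<in> sets P"
        using A_F sub by (auto simp: subalgebra_def)
      show ?case
      proof (rule integrable_const_bound[where B = "R\<^sup>2"])
        show "AE \<omega> in P. norm (indicator A \<omega> * (norm (x 0 \<omega>))\<^sup>2) \<le> R\<^sup>2"
          by (auto simp: A_def indicator_def intro!: power_mono)
      qed (use \<open>A \<in> sets P\<close> in simp)
    next
      case (Suc n)
      show ?case
        using lyapunov_step.next_square_integrable[OF step[OF Suc]] next_cong(2)[of "\<lambda>y. (norm y)\<^sup>2"]
        by blast
    qed
    define C where "C = 2 * K * (2 * ((norm (h 0))\<^sup>2 + L\<^sup>2) + Cm) * (1 + C5)"
    define u where "u n = (\<integral>\<omega>. indicator A \<omega> * (1 + V (x n \<omega>)) \<partial>P)" for n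
    have "u n \<le> exp (suminf (\<lambda>n. C * (a n)\<^sup>2)) * u 0" for n
    proof (rule discrete_Gronwall_bounded)
      show "u (Suc n) \<le> (1 + C * (a n)\<^sup>2) * u n" for n
        unfolding u_def C_def next_cong(1)[of "\<lambda>y. 1 + V y" n]
        by (rule lyapunov_step.expected_lyapunov_step[OF step[OF sq] A2_pos])
      show "0 \<le> u n" for n
        unfolding u_def using V_nonneg
        by (intro Bochner_Integration.integral_nonneg mult_nonneg_nonneg) (auto intro: add_nonneg_nonneg)
      show "0 \<le> C * (a n)\<^sup>2" for n
        unfolding C_def using K Cm C5(1) by (intro mult_nonneg_nonneg) auto
      show "summable (\<lambda>n. C * (a n)\<^sup>2)"
        by (intro summable_mult A2_sq)
    qed
    then show ?thesis
      using lyapunov_step.integrable_A_one_plus_V[OF step[OF sq]] unfolding u_def A_def by blast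
  qed

  show ?thesis
    unfolding tight_sequence_def
  proof (intro allI impI)
    fix \<epsilon> :: real
    assume "0 < \<epsilon>"
    \<comment> \<open>Half of \<open>\<epsilon>\<close> pays for a large initial value, the other half for a large value of \<open>V\<close>.\<close>
    obtain R where R: "prob {\<omega> \<in> space P. R < norm (x 0 \<omega>)} < \<epsilon> / 2"
      using norm_tail_small[OF x0, of "\<epsilon> / 2"] \<open>0 < \<epsilon>\<close> by auto
    let ?f = "\<lambda>n \<omega>. indicator {\<omega> \<in> space P. norm (x 0 \<omega>) \<le> R} \<omega> * (1 + V (x n \<omega>))"
    obtain B where B: "\<And>n. integrable P (?f n)" "\<And>n. (\<integral>\<omega>. ?f n \<omega> \<partial>P) \<le> B"
      using bounded_on_start[of R] by blast
    \<comment> \<open>The summand 1 keeps the level positive when \<open>B\<close> is 0.\<close>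
    define T where "T = 2 * \<bar>B\<bar> / \<epsilon> + 1"
    have T: "0 < T" "B / T \<le> \<epsilon> / 2"
    proof -
      show "0 < T"
        using \<open>0 < \<epsilon>\<close> by (auto simp: T_def intro!: add_nonneg_pos)
      have "B \<le> \<epsilon> / 2 * T"
        using \<open>0 < \<epsilon>\<close> by (simp add: T_def algebra_simps)
      then show "B / T \<le> \<epsilon> / 2"
        using \<open>0 < T\<close> by (simp add: pos_divide_le_eq)
    qed
    have "measure P {\<omega> \<in> space P. x n \<omega> \<in> {y. V y \<le> T}} > 1 - \<epsilon>" for n
    proof -
      have "prob {\<omega> \<in> space P. T \<le> ?f n \<omega>} \<le> (\<integral>\<omega>. ?f n \<omega> \<partial>P) / T"
      proof (rule integral_Markov_inequality_measure[OF B(1) sets.empty_sets])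
        show "AE \<omega> in P. 0 \<le> ?f n \<omega>"
          using V_nonneg by (auto intro!: mult_nonneg_nonneg add_nonneg_nonneg)
      qed (rule T)
      also have "\<dots> \<le> B / T"
        using B(2) T by (intro divide_right_mono) auto
      finally have exceed: "prob {\<omega> \<in> space P. T \<le> ?f n \<omega>} \<le> \<epsilon> / 2"
        using T(2) by (rule order_trans)
      have "prob {\<omega> \<in> space P. \<not> V (x n \<omega>) \<le> T}
          \<le> prob ({\<omega> \<in> space P. R < norm (x 0 \<omega>)} \<union> {\<omega> \<in> space P. T \<le> ?f n \<omega>})"
        by (intro finite_measure_mono) (auto simp: indicator_def)
      also have "\<dots> \<le> prob {\<omega> \<in> space P. R < norm (x 0 \<omega>)} + prob {\<omega> \<in> space P. T \<le> ?f n \<omega>}"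
        by (intro measure_Un_le) auto
      also have "\<dots> < \<epsilon>"
        using R exceed by simp
      finally have "prob {\<omega> \<in> space P. \<not> V (x n \<omega>) \<le> T} < \<epsilon>" .
      moreover have "prob {\<omega> \<in> space P. \<not> V (x n \<omega>) \<le> T} = 1 - prob {\<omega> \<in> space P. V (x n \<omega>) \<le> T}"
        by (rule prob_neg) simp
      ultimately show ?thesis
        by simp
    qed
    then show "\<exists>K. compact K \<and> (\<forall>n. measure P {\<omega> \<in> space P. x n \<omega> \<in> K} > 1 - \<epsilon>)"
      using coercive_sublevel_compact[OF V_cont V_coercive] by blast
  qed
qed

end
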